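(* Let $a,b$ be natural numbers with $\gcd(10a,b)=1$ and $a<b$. Let $e$ be the multiplicative order of $10$ modulo $b$, and let $a/b=0.\dot{c_1}\cdots\dot{c_e}=0.c_1\cdots c_ec_1\cdots c_e\cdots$ ($0\le c_i\le 9$) be the purely periodic decimal expansion of $a/b$. Suppose $e=ln$ for natural numbers $l$ and $n>1$. Define natural numbers $L,B$ by $L=\gcd(10^l-1,b)$ and $b=BL$. For $i=0,1,\dots,n-1$ let $s_i$ be the integer with $0\le s_i<b$ and $s_i\equiv 10^{li}a \pmod b$. For $j=0,\dots,n-1$ let $N_j$ denote the integer whose decimal digits are $c_{jl+1}c_{jl+2}\cdots c_{(j+1)l}$. Then $k:=\sum_{i=0}^{n-1}s_i/B$ is an integer and $$N_0+N_1+\dots+N_{n-1}=k\,\frac{10^l-1}{L}.$$ Moreover, in the case $a=1$, $n=2$, the integer $k$ is uniquely determined by the conditions $Bk\equiv 2\pmod L$ and $1\le k\le L$. *)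

theory Defs
  imports Complex_Main "HOL-Number_Theory.Number_Theory"
begin

text \<open>
  The expansion $x = 0.\dot{c_1}\cdots\dot{c_e}$. Only the digits with indices \<open>1..e\<close> are used;
  the digit at decimal place \<open>m + 1\<close> of the periodic expansion is \<open>c (m mod e + 1)\<close>.
\<close>
definition pure_periodic_decimal :: "real \<Rightarrow> nat \<Rightarrow> (nat \<Rightarrow> nat) \<Rightarrow> bool" where
  "pure_periodic_decimal x e c \<longleftrightarrow>
     0 < e \<and> (\<forall>i\<in>{1..e}. c i \<le> 9) \<and>
     (\<lambda>m. real (c (m mod e + 1)) / 10 ^ (m + 1)) sums x"

text \<open>The number with decimal digits $c_{jl+1}c_{jl+2}\cdots c_{(j+1)l}$, most significant first.\<close>
definition digit_block :: "(nat \<Rightarrow> nat) \<Rightarrow> nat \<Rightarrow> nat \<Rightarrow> nat" where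
  "digit_block c l j = (\<Sum>t=1..l. c (j * l + t) * 10 ^ (l - t))"

end

theory Submission imports Defs begin

text \<open>
  Let \<open>T i\<close> be the real number whose decimal expansion is that of \<open>a / b\<close> with the first \<open>l * i\<close>
  digits removed. Then \<open>T (i + 1) = 10 ^ l * T i - N i\<close> for the block \<open>N i\<close>, so \<open>b * T i\<close> is an
  integer congruent to \<open>10 ^ (l * i) * a\<close> modulo \<open>b\<close>; as it lies in \<open>[0, b]\<close> and is coprime to
  \<open>b\<close>, it equals \<open>s i\<close>. By periodicity \<open>T n = T 0\<close>, and summing the recurrence gives
  \<open>\<Sum> N j = (10 ^ l - 1) * \<Sum> s i / b\<close>.

  Moreover \<open>(10 ^ l - 1) * \<Sum> s i \<equiv> a * (10 ^ e - 1) \<equiv> 0\<close> modulo \<open>b\<close>, and \<open>B\<close> is coprime to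
  \<open>(10 ^ l - 1) / L\<close>, hence \<open>B\<close> divides \<open>\<Sum> s i\<close>. For \<open>a = 1\<close> and \<open>n = 2\<close> the same argument gives
  \<open>B dvd 10 ^ l + 1\<close>, so that \<open>B\<close>, being odd, is coprime to \<open>L\<close> and can be cancelled modulo \<open>L\<close>.
\<close>

text \<open>Multiplying by \<open>10 ^ l\<close> moves the decimal point, so the first
  \<open>l\<close> terms become an integer and the rest is again an expansion. The digits
  \<open>d\<close> count from 0, hence the index \<open>t - 1\<close>.\<close>

lemma decimal_expansion_drop:
  fixes d :: "nat \<Rightarrow> nat" and x :: real
  assumes "(\<lambda>m. real (d m) / 10 ^ (m + 1)) sums x"
  shows "(\<lambda>m. real (d (m + l)) / 10 ^ (m + 1)) sums
           (10 ^ l * x - real (\<Sum>t=1..l. d (t - 1) * 10 ^ (l - t)))"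
proof -
  have "(\<lambda>m. real (d (m + l)) / 10 ^ (m + l + 1)) sums (x - (\<Sum>m<l. real (d m) / 10 ^ (m + 1)))"
    using sums_split_initial_segment[OF assms, of l] by simp
  then have "(\<lambda>m. 10 ^ l * (real (d (m + l)) / 10 ^ (m + l + 1))) sums
      (10 ^ l * (x - (\<Sum>m<l. real (d m) / 10 ^ (m + 1))))"
    by (rule sums_mult)
  moreover have "10 ^ l * (real (d (m + l)) / 10 ^ (m + l + 1)) = real (d (m + l)) / 10 ^ (m + 1)"
    for m by (simp add: power_add)
  moreover have "10 ^ l * (\<Sum>m<l. real (d m) / 10 ^ (m + 1)) =
      real (\<Sum>t=1..l. d (t - 1) * 10 ^ (l - t))"
  proof -
    have "10 ^ l * (\<Sum>m<l. real (d m) / 10 ^ (m + 1)) =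
        (\<Sum>m<l. real (d m) * 10 ^ (l - Suc m))"
      unfolding sum_distrib_left
    proof (rule sum.cong[OF refl])
      fix m assume "m \<in> {..<l}"
      then have "(10::real) ^ l = 10 ^ (l - Suc m) * 10 ^ (m + 1)"
        by (simp flip: power_add power_Suc)
      then show "10 ^ l * (real (d m) / 10 ^ (m + 1)) = real (d m) * 10 ^ (l - Suc m)"
        by simp
    qed
    also have "\<dots> = real (\<Sum>t=1..l. d (t - 1) * 10 ^ (l - t))"
      by (simp add: sum.atLeast1_atMost_eq)
    finally show ?thesis .
  qed
  ultimately show ?thesis
    by (simp add: right_diff_distrib)
qed

text \<open>Comparison with the zero series and with 0.999... = 1. The upper bound cannot be strict,
  since all digits may be 9.\<close>

lemma decimal_expansion_bounds:
  fixes d :: "nat \<Rightarrow> nat" and x :: real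
  assumes "(\<lambda>m. real (d m) / 10 ^ (m + 1)) sums x" and "\<And>m. d m \<le> 9"
  shows "0 \<le> x" and "x \<le> 1"
proof -
  show "0 \<le> x"
    by (rule sums_le[OF _ sums_zero assms(1)]) simp
  have "(\<lambda>m. 9 / 10 * (1 / 10 :: real) ^ m) sums (9 / 10 * (1 / (1 - 1 / 10)))"
    by (intro sums_mult geometric_sums) simp
  then have "(\<lambda>m. 9 / 10 * (1 / 10 :: real) ^ m) sums 1"
    by simp
  moreover have "real (d m) / 10 ^ (m + 1) \<le> 9 / 10 * (1 / 10) ^ m" for m
    using assms(2)[of m] by (simp add: power_divide divide_simps)
  ultimately show "x \<le> 1"
    by (intro sums_le[OF _ assms(1)])
qed

text \<open>Dividing \<open>m\<close> and \<open>b\<close> by their gcd \<open>L\<close> leaves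
  coprime \<open>q\<close> and \<open>B\<close>, so \<open>q\<close> can be cancelled from
  \<open>B dvd q * x\<close>.\<close>

lemma cofactor_gcd_dvd:
  fixes b m x B L :: int
  assumes "b \<noteq> 0" and "b = B * L" and "L = gcd m b" and "b dvd m * x"
  shows "B dvd x"
proof -
  have "L dvd m" using assms(3) by simp
  then obtain q where q: "m = L * q" by (elim dvdE)
  have "0 < L" using assms(1,3) by (metis gcd_pos_int)
  have "L * gcd q B = gcd m b"
    using gcd_mult_distrib_int[of L q B] \<open>0 < L\<close> by (simp add: q assms(2) mult.commute)
  with assms(3) have "L * gcd q B = L * 1" by simp
  with \<open>0 < L\<close> have "gcd B q = 1"
    by (subst gcd.commute) (simp only: mult_cancel_left, simp)
  then have "coprime B q" by (simp only: coprime_iff_gcd_eq_1)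
  moreover have "B dvd q * x"
  proof -
    have "L * B dvd L * (q * x)" using assms(2,4) q by (simp add: mult.commute mult.assoc)
    then show ?thesis using \<open>0 < L\<close> by simp
  qed
  ultimately show ?thesis
    by (simp add: coprime_dvd_mult_right_iff)
qed

lemma pure_periodic_block_sum:
  fixes a b l n :: nat and c :: "nat \<Rightarrow> nat" and s :: "nat \<Rightarrow> int"
  assumes "1 < b" and cop: "coprime (10 * a) b"
    and dec: "pure_periodic_decimal (real a / real b) (l * n) c"
    and s: "\<And>i. i < n \<Longrightarrow> 0 \<le> s i \<and> s i < int b \<and> [s i = 10 ^ (l * i) * int a] (mod int b)"
  shows "real (\<Sum>j<n. digit_block c l j) = (10 ^ l - 1) * (\<Sum>i<n. real_of_int (s i) / real b)"
proof -
  define d where "d m = c (m mod (l * n) + 1)" for m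
  define T where "T i = (\<Sum>m. real (d (m + l * i)) / 10 ^ (m + 1))" for i
  have "0 < l * n" and d_le: "d m \<le> 9" for m
    using dec unfolding pure_periodic_decimal_def d_def by (auto simp: Suc_le_eq)
  have d_sums: "(\<lambda>m. real (d m) / 10 ^ (m + 1)) sums (real a / real b)"
    using dec unfolding pure_periodic_decimal_def d_def by simp
  have T_sums: "(\<lambda>m. real (d (m + l * i)) / 10 ^ (m + 1)) sums T i" for i
    unfolding T_def using decimal_expansion_drop[OF d_sums] by (intro summable_sums) (rule sums_summable)
  have T_0: "T 0 = real a / real b"
    using T_sums[of 0] d_sums by (simp add: sums_unique2)
  have T_n: "T n = T 0"
    by (simp add: T_def d_def)
  have block: "digit_block c l i = (\<Sum>t=1..l. d (t - 1 + l * i) * 10 ^ (l - t))" if "i < n" for i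
    unfolding digit_block_def
  proof (rule sum.cong[OF refl])
    fix t assume t: "t \<in> {1..l}"
    \<comment> \<open>Block \<open>i\<close> lies inside the first period, so the \<open>mod\<close>
      in \<open>d\<close> has no effect on its indices.\<close>
    have "l * Suc i \<le> l * n"
      using that by (intro mult_le_mono2) simp
    with t have "t - 1 + l * i < l * n" by auto
    with t have "d (t - 1 + l * i) = c (i * l + t)"
      unfolding d_def by (simp add: mult.commute add.commute)
    then show "c (i * l + t) * 10 ^ (l - t) = d (t - 1 + l * i) * 10 ^ (l - t)" by simp
  qed
  have T_Suc: "T (Suc i) = 10 ^ l * T i - real (digit_block c l i)" if "i < n" for i
    using decimal_expansion_drop[OF T_sums[of i], of l] T_sums[of "Suc i"] block[OF that]
    by (simp add: sums_unique2 ac_simps)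
  have numerator: "\<exists>r. T i = real_of_int r / real b \<and> [r = 10 ^ (l * i) * int a] (mod int b)"
    if "i \<le> n" for i
    using that
  proof (induction i)
    case 0
    show ?case using T_0 by (intro exI[of _ "int a"]) simp
  next
    case (Suc i)
    then obtain r where r: "T i = real_of_int r / real b" "[r = 10 ^ (l * i) * int a] (mod int b)"
      by auto
    \<comment> \<open>This is the recurrence \<open>T_Suc\<close> multiplied by \<open>b\<close>;
      the subtracted multiple of \<open>b\<close> vanishes in the congruence.\<close>
    let ?r = "10 ^ l * r - int (digit_block c l i) * int b"
    have "T (Suc i) = real_of_int ?r / real b"
      using T_Suc[of i] Suc.prems r(1) \<open>1 < b\<close> by (simp add: diff_divide_distrib)
    moreover have "[?r = 10 ^ l * (10 ^ (l * i) * int a) - 0] (mod int b)"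
      by (intro cong_diff cong_mult cong_refl r(2)) (simp add: cong_0_iff)
    ultimately show ?case
      by (intro exI[of _ ?r]) (simp add: power_add mult.assoc)
  qed
  have T_eq: "T i = real_of_int (s i) / real b" if "i < n" for i
  proof -
    obtain r where r: "T i = real_of_int r / real b" "[r = 10 ^ (l * i) * int a] (mod int b)"
      using numerator[of i] \<open>i < n\<close> by auto
    have "0 \<le> T i" "T i \<le> 1"
      using decimal_expansion_bounds[OF T_sums d_le] by auto
    then have "0 \<le> real_of_int r" "real_of_int r \<le> real_of_int (int b)"
      using \<open>1 < b\<close> unfolding r(1) by (simp_all add: divide_simps)
    then have "0 \<le> r" "r \<le> int b"
      by (simp_all only: of_int_0_le_iff of_int_le_iff)
    \<comment> \<open>The bounds still allow \<open>T i = 1\<close>. Then \<open>b > 1\<close> would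
      divide a number coprime to it.\<close>
    moreover have "r \<noteq> int b"
    proof
      assume "r = int b"
      with r(2) have "int b dvd 10 ^ (l * i) * int a"
        by (metis cong_dvd_iff dvd_refl)
      moreover have "coprime (int b) (10 ^ (l * i) * int a)"
      proof -
        have "coprime b (10 ^ (l * i) * a)"
          using cop by (simp add: coprime_commute)
        then show ?thesis
          by (metis coprime_int_iff of_nat_mult of_nat_numeral of_nat_power)
      qed
      ultimately have "is_unit (int b)"
        by (metis coprime_absorb_left)
      then show False
        using \<open>1 < b\<close> by simp
    qed
    moreover have "[r = s i] (mod int b)"
      using r(2) s[OF that] by (meson cong_sym cong_trans)
    ultimately have "r = s i"
      using s[OF that] by (intro cong_less_imp_eq_int) auto
    with r(1) show ?thesis by simp
  qed
  have "(\<Sum>j<n. real (digit_block c l j)) = (\<Sum>j<n. 10 ^ l * T j - T (Suc j))"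
    using T_Suc by (intro sum.cong) auto
  \<comment> \<open>The split-off differences telescope to \<open>T n - T 0 = 0\<close>.\<close>
  also have "\<dots> = (\<Sum>j<n. (10 ^ l - 1) * T j - (T (Suc j) - T j))"
    by (intro sum.cong) (auto simp: algebra_simps)
  also have "\<dots> = (10 ^ l - 1) * (\<Sum>j<n. T j)"
    by (simp only: sum_subtractf[of "\<lambda>j. (10 ^ l - 1) * T j"] sum_lessThan_telescope T_n
        flip: sum_distrib_left)
  finally show ?thesis
    using T_eq by simp
qed

theorem theorem2p1:
  fixes a b e l n L B :: nat and c :: "nat \<Rightarrow> nat" and s :: "nat \<Rightarrow> int"
  assumes "0 < a" and "gcd (10 * a) b = 1" and "a < b"
    and "e = ord b 10"
    and "pure_periodic_decimal (real a / real b) e c"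
    and "0 < l" and "1 < n" and "e = l * n"
    and "L = gcd (10 ^ l - 1) b" and "b = B * L"
    and "\<And>i. i < n \<Longrightarrow> 0 \<le> s i \<and> s i < int b \<and> [s i = 10 ^ (l * i) * int a] (mod int b)"
  shows "\<exists>k::int.
      real_of_int k = (\<Sum>i<n. real_of_int (s i) / real B) \<and>
      real (\<Sum>j<n. digit_block c l j) = real_of_int k * ((10 ^ l - 1) / real L) \<and>
      (a = 1 \<and> n = 2 \<longrightarrow>
        (\<forall>k'::int. [int B * k' = 2] (mod int L) \<and> 1 \<le> k' \<and> k' \<le> int L \<longleftrightarrow> k' = k))"
proof -
  have "1 < b" using assms(1,3) by simp
  then have "0 < B" "0 < L" using assms(10) by (auto intro!: Nat.gr0I)
  have cop: "coprime (10 * a) b" using assms(2) by (simp only: coprime_iff_gcd_eq_1)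
  have int_b: "int b = int B * int L" using assms(10) by simp
  have int_L: "int L = gcd (10 ^ l - 1) (int b)"
    using assms(9) by (simp add: of_nat_diff flip: gcd_int_int_eq)
  have s_cong: "[s i = 10 ^ (l * i) * int a] (mod int b)" if "i < n" for i
    using assms(11)[OF that] by simp
  have "int b dvd 10 ^ e - 1"
  proof -
    have "[10 ^ e = 1] (mod b)"
      using ord[of 10 b] assms(4) by simp
    then have "[int (10 ^ e) = int 1] (mod int b)"
      by (simp only: cong_int_iff)
    then show ?thesis by (simp add: cong_iff_dvd_diff)
  qed
  moreover have "(10 ^ l - 1) * (\<Sum>i<n. 10 ^ (l * i)) = (10 ^ e - 1 :: int)"
    using power_diff_1_eq[of "10 ^ l :: int" n] assms(8) by (simp add: power_mult)
  \<comment> \<open>Divisibility is shown for the geometric sum first: it carries over to the sum of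
    the \<open>s i\<close>, and for \<open>n = 2\<close> it reads
    \<open>B dvd 1 + 10 ^ l\<close>.\<close>
  ultimately have B_dvd_geom: "int B dvd (\<Sum>i<n. 10 ^ (l * i))"
    using cofactor_gcd_dvd[OF _ int_b int_L] \<open>1 < b\<close> by simp
  have "[(\<Sum>i<n. s i) = (\<Sum>i<n. 10 ^ (l * i)) * int a] (mod int b)"
    unfolding sum_distrib_right by (intro cong_sum s_cong) simp
  then have "[(\<Sum>i<n. s i) = (\<Sum>i<n. 10 ^ (l * i)) * int a] (mod int B)"
    using int_b cong_dvd_modulus by fastforce
  with B_dvd_geom have "int B dvd (\<Sum>i<n. s i)"
    using cong_dvd_iff dvd_mult2 by blast
  then obtain k where k: "(\<Sum>i<n. s i) = int B * k" by (elim dvdE)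
  have k_real: "(\<Sum>i<n. real_of_int (s i)) = real B * real_of_int k"
    using arg_cong[OF k, of real_of_int] by simp
  have "real (\<Sum>j<n. digit_block c l j) = (10 ^ l - 1) * (\<Sum>i<n. real_of_int (s i) / real b)"
    using pure_periodic_block_sum[OF \<open>1 < b\<close> cop] assms(5,8,11) by blast
  then have blocks: "real (\<Sum>j<n. digit_block c l j) = real_of_int k * ((10 ^ l - 1) / real L)"
    using k_real assms(10) \<open>0 < B\<close> by (simp flip: sum_divide_distrib)
  have "[int B * k' = 2] (mod int L) \<and> 1 \<le> k' \<and> k' \<le> int L \<longleftrightarrow> k' = k"
    if "a = 1" "n = 2" for k'
  proof -
    have s01: "s 0 + s 1 = int B * k"
      using k \<open>n = 2\<close> by (simp add: lessThan_nat_numeral lessThan_Suc numeral_2_eq_2)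
    have "[s 0 = 1] (mod int b)"
      using s_cong[of 0] that by simp
    then have "s 0 = 1"
      using assms(11)[of 0] \<open>n = 2\<close> \<open>1 < b\<close> by (intro cong_less_imp_eq_int[of _ "int b"]) auto
    have B_dvd: "int B dvd 1 + 10 ^ l"
      using B_dvd_geom \<open>n = 2\<close> by (simp add: lessThan_Suc numeral_2_eq_2 add.commute)
    have L_dvd: "int L dvd 10 ^ l - 1"
      using int_L by simp
    have "coprime (int B) (int L)"
    proof (rule coprimeI)
      fix g assume g: "g dvd int B" "g dvd int L"
      \<comment> \<open>A common divisor of \<open>B\<close> and \<open>L\<close> divides 2, but it
        is odd because \<open>b\<close> is coprime to 10.\<close>
      have "g dvd (1 + 10 ^ l) - (10 ^ l - 1)"
        using g B_dvd L_dvd by (meson dvd_diff dvd_trans)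
      then have "g dvd 2" by simp
      moreover have "coprime g 2"
      proof -
        have "odd b" using cop by auto
        then have "odd (int B)" using assms(10) by simp
        then have "odd g" using g(1) dvd_trans by blast
        then show ?thesis by simp
      qed
      ultimately show "is_unit g" by (metis coprime_absorb_left)
    qed
    \<comment> \<open>The middle term is \<open>1 + s 1\<close> with \<open>0 \<le> s 1 < b\<close>,
      and \<open>b = B * L\<close>.\<close>
    have "0 < int B * k" "int B * k \<le> int B * int L"
      using s01 \<open>s 0 = 1\<close> assms(11)[of 1] \<open>n = 2\<close> int_b by auto
    then have k_range: "1 \<le> k" "k \<le> int L"
      using \<open>0 < B\<close> by (auto simp: zero_less_mult_iff)
    have "[s 1 = 10 ^ l] (mod int L)"
      using s_cong[of 1] that int_b by (metis cong_dvd_modulus dvd_triv_right mult.right_neutral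
          of_nat_1 one_less_numeral_iff semiring_norm(76))
    also have "[10 ^ l = 1] (mod int L)"
      using L_dvd by (simp add: cong_iff_dvd_diff)
    finally have "[1 + s 1 = 1 + 1] (mod int L)"
      by (intro cong_add cong_refl)
    then have k_cong: "[int B * k = 2] (mod int L)"
      using s01 \<open>s 0 = 1\<close> by simp
    show ?thesis
    proof
      assume k': "[int B * k' = 2] (mod int L) \<and> 1 \<le> k' \<and> k' \<le> int L"
      then have "[int B * k' = int B * k] (mod int L)"
        using k_cong by (meson cong_sym cong_trans)
      then have "[k' = k] (mod int L)"
        using \<open>coprime (int B) (int L)\<close> by (simp add: cong_mult_lcancel)
      \<comment> \<open>Shifting by 1 moves the range from 1 to \<open>L\<close> onto the standard
        residues from 0 to \<open>L - 1\<close>, where congruence means equality.\<close>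
      then have "[k' - 1 = k - 1] (mod int L)"
        by (intro cong_diff cong_refl)
      then have "k' - 1 = k - 1"
        using k' k_range by (intro cong_less_imp_eq_int[of _ "int L"]) auto
      then show "k' = k" by simp
    qed (use k_cong k_range in simp)
  qed
  moreover have "real_of_int k = (\<Sum>i<n. real_of_int (s i) / real B)"
    using k_real \<open>0 < B\<close> by (simp flip: sum_divide_distrib)
  ultimately show ?thesis
    using blocks by blast
qed

end
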